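(* For every triangle-free $\{0,1\}$-valued step graphon $W$ (in particular, the step graphon $W_G$ of any finite triangle-free graph $G$), one has $d_{\mathrm{mono}}(W)\le U_7(W)$, with equality when $W$ is the graphon of the balanced blow-up of the $5$-cycle, i.e. $W=W_{C_5}$.
   Context: A graphon is a symmetric measurable function $W:[0,1]^2\to[0,1]$. It is a $\{0,1\}$-valued step graphon if $[0,1]$ can be partitioned into finitely many measurable sets $P_1,\dots,P_k$ such that $W$ is constant, with value $0$ or $1$, on each $P_i\times P_j$. It is triangle-free if $\int_{[0,1]^3}W(x,y)W(y,z)W(x,z)\,dx\,dy\,dz=0$. For a finite graph $G$ on $N$ vertices, $W_G$ is the step graphon with $N$ parts of equal measure indexed by the vertices, equal to $1$ on $P_u\times P_v$ if $uv$ is an edge and $0$ otherwise; it is also the step graphon of every balanced blow-up of $G$. In particular $W_{C_5}$ represents all balanced blow-ups $C_5[m]$. Monochromatic density. For a measurable $2$-colouring $\varphi:[0,1]\to\{0,1\}$ put $\mathrm{mono}_W(\varphi)=\int_{[0,1]^2}W(x,y)\mathbf 1[\varphi(x)=\varphi(y)]\,dx\,dy$, and let $d_{\mathrm{mono}}(W)=\inf_\varphi \mathrm{mono}_W(\varphi)$. For a finite graph $G$ on $N$ vertices, $d_{\mathrm{mono}}(W_G)=2\beta(G)/N^2$, where $\beta(G)$ is the minimum number of edges whose deletion makes $G$ bipartite. Per-root-MaxCut envelope. Let $\mathcal T_7$ be the set of isomorphism classes of triangle-free graphs on $7$ vertices, each with a fixed canonical representative $\sigma$ on the vertex set $\{1,\dots,7\}$.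 Sample $R=(x_1,\dots,x_7)$ i.i.d. uniformly from $[0,1]$; the induced graph on $R$ joins $i,j$ ($i\neq j$) iff $W(x_i,x_j)=1$. Almost surely this graph is isomorphic to a unique $\sigma\in\mathcal T_7$ (the type of $R$); relabel the roots by the lexicographically least isomorphism from $\sigma$ to the induced graph, obtaining roots $r_1,\dots,r_7$ in canonical order. Let $p_\sigma(W)$ be the probability that $R$ has type $\sigma$, so $\sum_\sigma p_\sigma(W)=1$. The profile of a point $v\in[0,1]$ is $\pi_\sigma(v)=(W(v,r_1),\dots,W(v,r_7))\in\{0,1\}^7$. A rule is a function $c:\{0,1\}^7\to\{0,1\}$; given $R$ of type $\sigma$ it defines the $2$-colouring $\varphi_{R,c}(v)=c(\pi_\sigma(v))$ (the roots form a null set and are irrelevant). Let $\mathbb E[C\mid\sigma,c]$ be the conditional expectation of $\mathrm{mono}_W(\varphi_{R,c})$ given that $R$ has type $\sigma$. Define $$U_7(W)=\sum_{\sigma\in\mathcal T_7}p_\sigma(W)\,\min_{c}\,\mathbb E[C\mid\sigma,c],$$ where the minimum is over all rules $c:\{0,1\}^7\to\{0,1\}$ and terms with $p_\sigma(W)=0$ are taken to be $0$. *)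

theory Defs
  imports "HOL-Analysis.Analysis" "HOL-Combinatorics.Permutations" "HOL-Library.Fun_Lexorder"
begin

section \<open>Finite simple graphs\<close>

text \<open>Edge sets are symmetric irreflexive relations: each edge \<open>uv\<close> contributes both
  \<open>(u, v)\<close> and \<open>(v, u)\<close>.\<close>

definition simple_graph :: "'v set \<Rightarrow> ('v \<times> 'v) set \<Rightarrow> bool" where
  "simple_graph V E \<longleftrightarrow> finite V \<and> E \<subseteq> V \<times> V \<and> sym E \<and> irrefl E"

definition triangle_free_graph :: "('v \<times> 'v) set \<Rightarrow> bool" where
  "triangle_free_graph E \<longleftrightarrow> \<not> (\<exists>u v w. (u, v) \<in> E \<and> (v, w) \<in> E \<and> (u, w) \<in> E)"

definition C5_edges :: "(nat \<times> nat) set" where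
  "C5_edges = {(i, j). i < 5 \<and> j < 5 \<and> (j = (i + 1) mod 5 \<or> i = (j + 1) mod 5)}"


section \<open>Graphons\<close>

text \<open>The unit interval with Lebesgue measure. Graphons are functions on \<open>real \<times> real\<close> of which
  only the values on the unit square matter.\<close>

definition unit_leb :: "real measure" where
  "unit_leb = lebesgue_on {0..1}"

text \<open>Measurability on the square refers to the product of the Lebesgue sigma-algebras on
  \<open>[0,1]\<close>, not to its completion; for step functions the two notions agree.\<close>

definition graphon :: "(real \<Rightarrow> real \<Rightarrow> real) \<Rightarrow> bool" where
  "graphon W \<longleftrightarrow>
     (\<lambda>(x, y). W x y) \<in> borel_measurable (unit_leb \<Otimes>\<^sub>M unit_leb) \<and>
     (\<forall>x\<in>{0..1}. \<forall>y\<in>{0..1}. W x y \<in> {0..1} \<and> W x y = W y x)"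

definition zero_one_step_graphon :: "(real \<Rightarrow> real \<Rightarrow> real) \<Rightarrow> bool" where
  "zero_one_step_graphon W \<longleftrightarrow> graphon W \<and>
     (\<exists>\<P>. finite \<P> \<and> partition_on {0..1} \<P> \<and> \<P> \<subseteq> sets unit_leb \<and>
        (\<forall>A\<in>\<P>. \<forall>B\<in>\<P>. \<exists>c\<in>{0, 1}. \<forall>x\<in>A. \<forall>y\<in>B. W x y = c))"

definition triangle_free_graphon :: "(real \<Rightarrow> real \<Rightarrow> real) \<Rightarrow> bool" where
  "triangle_free_graphon W \<longleftrightarrow>
     (LINT (x, y, z)|(unit_leb \<Otimes>\<^sub>M unit_leb \<Otimes>\<^sub>M unit_leb). W x y * W y z * W x z) = 0"

text \<open>\<open>W\<close> is the step graphon \<open>W\<^sub>G\<close> of \<open>G = (V, E)\<close> on the unit square. Which parts of equal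
  measure are used is immaterial, so every choice of them is admitted.\<close>

definition is_graph_graphon :: "'v set \<Rightarrow> ('v \<times> 'v) set \<Rightarrow> (real \<Rightarrow> real \<Rightarrow> real) \<Rightarrow> bool" where
  "is_graph_graphon V E W \<longleftrightarrow>
     (\<exists>P. disjoint_family_on P V \<and> (\<Union>v\<in>V. P v) = {0..1} \<and>
        (\<forall>v\<in>V. P v \<in> sets unit_leb \<and> measure unit_leb (P v) = 1 / card V) \<and>
        (\<forall>u\<in>V. \<forall>v\<in>V. \<forall>x\<in>P u. \<forall>y\<in>P v. W x y = (if (u, v) \<in> E then 1 else 0)))"


section \<open>Monochromatic density\<close>

definition colourings :: "(real \<Rightarrow> nat) set" where
  "colourings = measurable unit_leb (count_space {0, 1})"

definition mono_density :: "(real \<Rightarrow> real \<Rightarrow> real) \<Rightarrow> (real \<Rightarrow> nat) \<Rightarrow> real" where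
  "mono_density W \<phi> =
     (LINT (x, y)|(unit_leb \<Otimes>\<^sub>M unit_leb). W x y * (if \<phi> x = \<phi> y then 1 else 0))"

definition d_mono :: "(real \<Rightarrow> real \<Rightarrow> real) \<Rightarrow> real" where
  "d_mono W = (INF \<phi>\<in>colourings. mono_density W \<phi>)"


section \<open>The per-root-MaxCut envelope\<close>

definition graph_iso :: "(nat \<Rightarrow> nat) \<Rightarrow> (nat \<times> nat) set \<Rightarrow> (nat \<times> nat) set \<Rightarrow> bool" where
  "graph_iso f \<sigma> G \<longleftrightarrow> f permutes {1..7} \<and>
     (\<forall>i\<in>{1..7}. \<forall>j\<in>{1..7}. (i, j) \<in> \<sigma> \<longleftrightarrow> (f i, f j) \<in> G)"

text \<open>A choice of one canonical representative for each isomorphism class of triangle-free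
  graphs on \<open>7\<close> vertices.\<close>

definition canonical_types :: "(nat \<times> nat) set set \<Rightarrow> bool" where
  "canonical_types T \<longleftrightarrow>
     (\<forall>\<sigma>\<in>T. simple_graph {1..7} \<sigma> \<and> triangle_free_graph \<sigma>) \<and>
     (\<forall>G. simple_graph {1..7} G \<and> triangle_free_graph G \<longrightarrow> (\<exists>!\<sigma>. \<sigma> \<in> T \<and> (\<exists>f. graph_iso f \<sigma> G)))"

text \<open>The isomorphism \<open>f\<close> with lexicographically least \<open>(f 1, \<dots>, f 7)\<close>: by \<^const>\<open>graph_iso\<close>
  all candidates agree outside \<open>{1..7}\<close>.\<close>

definition lex_least_iso :: "(nat \<times> nat) set \<Rightarrow> (nat \<times> nat) set \<Rightarrow> nat \<Rightarrow> nat" where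
  "lex_least_iso \<sigma> G =
     (THE f. graph_iso f \<sigma> G \<and> (\<forall>g. graph_iso g \<sigma> G \<longrightarrow> f = g \<or> less_fun f g))"

definition root_space :: "(nat \<Rightarrow> real) measure" where
  "root_space = (\<Pi>\<^sub>M i\<in>{1..7}. unit_leb)"

definition induced_graph :: "(real \<Rightarrow> real \<Rightarrow> real) \<Rightarrow> (nat \<Rightarrow> real) \<Rightarrow> (nat \<times> nat) set" where
  "induced_graph W x = {(i, j). i \<in> {1..7} \<and> j \<in> {1..7} \<and> i \<noteq> j \<and> W (x i) (x j) = 1}"

definition type_event :: "(real \<Rightarrow> real \<Rightarrow> real) \<Rightarrow> (nat \<times> nat) set \<Rightarrow> (nat \<Rightarrow> real) set" where
  "type_event W \<sigma> = {x \<in> space root_space. \<exists>f. graph_iso f \<sigma> (induced_graph W x)}"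

definition type_prob :: "(real \<Rightarrow> real \<Rightarrow> real) \<Rightarrow> (nat \<times> nat) set \<Rightarrow> real" where
  "type_prob W \<sigma> = measure root_space (type_event W \<sigma>)"

definition canonical_roots ::
  "(real \<Rightarrow> real \<Rightarrow> real) \<Rightarrow> (nat \<times> nat) set \<Rightarrow> (nat \<Rightarrow> real) \<Rightarrow> nat \<Rightarrow> real" where
  "canonical_roots W \<sigma> x i = x (lex_least_iso \<sigma> (induced_graph W x) i)"

definition profile :: "(real \<Rightarrow> real \<Rightarrow> real) \<Rightarrow> (nat \<Rightarrow> real) \<Rightarrow> real \<Rightarrow> nat \<Rightarrow> real" where
  "profile W r v = (\<lambda>i\<in>{1..7}. W v (r i))"

definition rules :: "((nat \<Rightarrow> real) \<Rightarrow> nat) set" where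
  "rules = ({1..7} \<rightarrow>\<^sub>E {0, 1}) \<rightarrow>\<^sub>E {0, 1}"

definition rule_colouring ::
  "(real \<Rightarrow> real \<Rightarrow> real) \<Rightarrow> (nat \<times> nat) set \<Rightarrow> (nat \<Rightarrow> real) \<Rightarrow> ((nat \<Rightarrow> real) \<Rightarrow> nat) \<Rightarrow> real \<Rightarrow> nat" where
  "rule_colouring W \<sigma> x c v = c (profile W (canonical_roots W \<sigma> x) v)"

definition cond_cost ::
  "(real \<Rightarrow> real \<Rightarrow> real) \<Rightarrow> (nat \<times> nat) set \<Rightarrow> ((nat \<Rightarrow> real) \<Rightarrow> nat) \<Rightarrow> real" where
  "cond_cost W \<sigma> c =
     (LINT x:type_event W \<sigma>|root_space. mono_density W (rule_colouring W \<sigma> x c)) / type_prob W \<sigma>"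

definition U7 :: "(nat \<times> nat) set set \<Rightarrow> (real \<Rightarrow> real \<Rightarrow> real) \<Rightarrow> real" where
  "U7 T W = (\<Sum>\<sigma>\<in>T. type_prob W \<sigma> * (MIN c\<in>rules. cond_cost W \<sigma> c))"


section \<open>The notions above are inhabited and well defined\<close>

lemma graph_iso_refl: "graph_iso id G G"
  by (simp add: graph_iso_def permutes_id)

lemma graph_iso_inv:
  assumes "graph_iso f G H" shows "graph_iso (inv f) H G"
proof -
  have f: "f permutes {1..7}" using assms by (simp add: graph_iso_def)
  have "(i, j) \<in> H \<longleftrightarrow> (inv f i, inv f j) \<in> G" if "i \<in> {1..7}" "j \<in> {1..7}" for i j
  proof -
    have "inv f i \<in> {1..7}" "inv f j \<in> {1..7}"
      using that permutes_in_image[OF permutes_inv[OF f]] by blast+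
    then have "(inv f i, inv f j) \<in> G \<longleftrightarrow> (f (inv f i), f (inv f j)) \<in> H"
      using assms unfolding graph_iso_def by blast
    then show ?thesis using permutes_inverses(1)[OF f] by simp
  qed
  then show ?thesis using permutes_inv[OF f] unfolding graph_iso_def by blast
qed

lemma graph_iso_comp:
  assumes "graph_iso f G H" "graph_iso g H K" shows "graph_iso (g \<circ> f) G K"
proof -
  have f: "f permutes {1..7}" and g: "g permutes {1..7}"
    using assms by (simp_all add: graph_iso_def)
  have "(i, j) \<in> G \<longleftrightarrow> ((g \<circ> f) i, (g \<circ> f) j) \<in> K" if "i \<in> {1..7}" "j \<in> {1..7}" for i j
  proof -
    have "f i \<in> {1..7}" "f j \<in> {1..7}" using that permutes_in_image[OF f] by blast+
    then show ?thesis using assms that unfolding graph_iso_def comp_def by blast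
  qed
  then show ?thesis using permutes_compose[OF f g] unfolding graph_iso_def by blast
qed

lemma canonical_types_exist: "\<exists>T. canonical_types T"
proof -
  define R where "R G H \<longleftrightarrow> (\<exists>f. graph_iso f G H)" for G H
  have R_refl: "R G G" for G using graph_iso_refl R_def by blast
  have R_sym: "R G H \<Longrightarrow> R H G" for G H using graph_iso_inv R_def by blast
  have R_trans: "R G H \<Longrightarrow> R H K \<Longrightarrow> R G K" for G H K
    unfolding R_def by (elim exE) (intro exI, rule graph_iso_comp)
  define S where "S = {G. simple_graph {1..7::nat} G \<and> triangle_free_graph G}"
  define rep where "rep G = (SOME H. H \<in> S \<and> R H G)" for G
  have rep: "rep G \<in> S \<and> R (rep G) G" if "G \<in> S" for G
    unfolding rep_def by (rule someI[of _ G]) (use that R_refl in blast)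
  have rep_eq: "rep G = rep H" if "R G H" for G H
  proof -
    have "R K G \<longleftrightarrow> R K H" for K using R_sym R_trans that by blast
    then show ?thesis by (simp add: rep_def)
  qed
  have "canonical_types (rep ` S)"
    unfolding canonical_types_def R_def[symmetric]
  proof (intro conjI ballI allI impI)
    fix \<sigma> assume "\<sigma> \<in> rep ` S"
    then show "simple_graph {1..7} \<sigma>" "triangle_free_graph \<sigma>" using rep S_def by auto
  next
    fix G assume "simple_graph {1..7::nat} G \<and> triangle_free_graph G"
    then have G: "G \<in> S" by (simp add: S_def)
    show "\<exists>!\<sigma>. \<sigma> \<in> rep ` S \<and> R \<sigma> G"
    proof (rule ex1I[of _ "rep G"])
      show "rep G \<in> rep ` S \<and> R (rep G) G" using G rep by blast
      fix \<sigma> assume "\<sigma> \<in> rep ` S \<and> R \<sigma> G"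
      then obtain H where H: "H \<in> S" "\<sigma> = rep H" "R (rep H) G" by blast
      then have "R H G" using rep R_sym R_trans by blast
      then show "\<sigma> = rep G" using rep_eq H by blast
    qed
  qed
  then show ?thesis by blast
qed

lemma lex_least_iso_exists:
  assumes "graph_iso f \<sigma> G"
  shows "\<exists>!f. graph_iso f \<sigma> G \<and> (\<forall>g. graph_iso g \<sigma> G \<longrightarrow> f = g \<or> less_fun f g)"
proof -
  define S where "S = {f. graph_iso f \<sigma> G}"
  have "finite S"
    by (rule finite_subset[OF _ finite_permutations[of "{1..7::nat}"]])
      (auto simp: S_def graph_iso_def)
  moreover have "S \<noteq> {}" using assms S_def by auto
  moreover have tri: "less_fun g h \<or> g = h \<or> less_fun h g" if "g \<in> S" "h \<in> S" for g h
  proof -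
    have "{k. g k \<noteq> h k} \<subseteq> {1..7}"
      using that unfolding S_def graph_iso_def permutes_def by force
    then have "finite {k. g k \<noteq> h k}" using finite_subset by blast
    then show ?thesis using less_fun_trichotomy by blast
  qed
  ultimately have ex: "\<exists>f\<in>S. \<forall>g\<in>S. f = g \<or> less_fun f g"
  proof (induction S rule: finite_ne_induct)
    case (insert x F)
    then obtain m where m: "m \<in> F" "\<forall>g\<in>F. m = g \<or> less_fun m g" by blast
    consider "less_fun x m" | "x = m" | "less_fun m x"
      using insert.prems[of x m] m(1) by blast
    then show ?case
    proof cases
      case 1
      then have "\<forall>g\<in>F. less_fun x g" using m(2) less_fun_trans[OF 1] by metis
      then show ?thesis by simp
    qed (use m in auto)
  qed auto
  then obtain m where m: "graph_iso m \<sigma> G" "\<And>g. graph_iso g \<sigma> G \<Longrightarrow> m = g \<or> less_fun m g"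
    unfolding S_def by blast
  show ?thesis
  proof (rule ex1I[of _ m])
    fix f assume f: "graph_iso f \<sigma> G \<and> (\<forall>g. graph_iso g \<sigma> G \<longrightarrow> f = g \<or> less_fun f g)"
    then have "f = m \<or> less_fun f m" "m = f \<or> less_fun m f" using m by blast+
    then show "f = m" using less_fun_asym[of f m] by blast
  qed (use m in blast)
qed

lemma graph_graphon_exists:
  assumes "finite V" "V \<noteq> {}"
  shows "\<exists>W. is_graph_graphon V E W"
proof -
  define N where "N = card V"
  have N: "N > 0" using assms N_def by (simp add: card_gt_0_iff)
  obtain h where h: "bij_betw h V {0..<N}" using assms ex_bij_betw_finite_nat N_def by blast
  define Q where "Q k = {real k / N..<(real k + 1) / N} \<union> (if k = 0 then {1} else {})" for k
  define idx where "idx x = (if x = 1 then 0 else nat \<lfloor>x * N\<rfloor>)" for x :: real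
  have mem: "x \<in> Q k \<longleftrightarrow> x \<in> {0..1} \<and> idx x = k" if "k < N" for x k
  proof (cases "x = 1")
    case True
    then show ?thesis using that by (auto simp: Q_def idx_def field_simps)
  next
    case False
    have "x \<in> Q k \<longleftrightarrow> real k \<le> x * N \<and> x * N < real k + 1"
      using False N by (auto simp: Q_def field_simps)
    also have "\<dots> \<longleftrightarrow> x \<in> {0..1} \<and> nat \<lfloor>x * N\<rfloor> = k"
    proof
      assume a: "real k \<le> x * N \<and> x * N < real k + 1"
      have "0 \<le> x * N" using a by linarith
      then have "0 \<le> x" using N by (simp add: zero_le_mult_iff)
      have "real k + 1 \<le> real N" using that by linarith
      then have "x * N < N" using a by linarith
      then have "x < 1" using N by simp
      with \<open>0 \<le> x\<close> a show "x \<in> {0..1} \<and> nat \<lfloor>x * N\<rfloor> = k" by (auto simp: nat_eq_iff floor_eq_iff)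
    next
      assume a: "x \<in> {0..1} \<and> nat \<lfloor>x * N\<rfloor> = k"
      then have "0 \<le> x * N" by auto
      then have "\<lfloor>x * N\<rfloor> = int k" using a by auto
      then show "real k \<le> x * N \<and> x * N < real k + 1" by linarith
    qed
    finally show ?thesis using False by (simp add: idx_def)
  qed
  have idx: "idx x < N" if x: "x \<in> {0..1}" for x
  proof (cases "x = 1")
    case False
    then have "x * N < N" using x N by simp
    then have "\<lfloor>x * N\<rfloor> < int N" by linarith
    then show ?thesis using False N unfolding idx_def by simp
  qed (simp add: idx_def N)
  define P where "P = Q \<circ> h"
  define W where "W x y = (if (inv_into V h (idx x), inv_into V h (idx y)) \<in> E then 1 else 0 :: real)"
    for x y
  have hV: "h v < N" if "v \<in> V" for v using h that by (auto simp: bij_betw_def)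
  have memP: "x \<in> P v \<longleftrightarrow> x \<in> {0..1} \<and> idx x = h v" if "v \<in> V" for x v
    using mem[OF hV[OF that]] by (simp add: P_def)
  have inj: "inj_on h V" using h by (simp add: bij_betw_def)
  have "disjoint_family_on P V"
    unfolding disjoint_family_on_def using memP inj by (auto dest: inj_onD)
  moreover have "(\<Union>v\<in>V. P v) = {0..1}"
  proof
    show "(\<Union>v\<in>V. P v) \<subseteq> {0..1}" using memP by blast
    show "{0..1} \<subseteq> (\<Union>v\<in>V. P v)"
    proof
      fix x :: real assume x: "x \<in> {0..1}"
      then obtain v where "v \<in> V" "h v = idx x"
        using idx h unfolding bij_betw_def by (metis atLeastLessThan_iff imageE le0)
      then show "x \<in> (\<Union>v\<in>V. P v)" using memP x by (intro UN_I[of v]) simp_all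
    qed
  qed
  moreover have "P v \<in> sets unit_leb \<and> measure unit_leb (P v) = 1 / card V" if v: "v \<in> V" for v
  proof -
    have sub: "P v \<subseteq> {0..1}" using memP v by blast
    have m: "P v \<in> sets lebesgue" by (simp add: P_def Q_def)
    have "measure lebesgue (P v) = measure lebesgue {real (h v) / N..<(real (h v) + 1) / N}"
      by (rule measure_negligible_symdiff)
        (auto simp: P_def Q_def intro: negligible_subset[of "{1}"] bounded_set_imp_lmeasurable
          bounded_subset[OF bounded_closed_interval])
    also have "\<dots> = 1 / N" using N by (simp add: field_simps)
    finally show ?thesis using sub m
      by (simp add: unit_leb_def N_def sets_restrict_space_iff measure_restrict_space)
  qed
  moreover have "W x y = (if (u, v) \<in> E then 1 else 0)"
    if "u \<in> V" "v \<in> V" "x \<in> P u" "y \<in> P v" for u v x y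
    using that memP inj by (simp add: W_def)
  ultimately show ?thesis unfolding is_graph_graphon_def by blast
qed

end

theory Submission
  imports Defs "HOL-Probability.Probability"
begin

text \<open>The cost of any rule is an average of costs of genuine colourings, hence at least the minimum
  monochromatic density; since almost every sample has exactly one type, the weighted sum of these
  averages is too. Measurability is a finite matter: for a step graphon everything depends only on
  the parts that contain the roots. For the balanced blow-up of the 5-cycle, the rule that colours a
  point by its adjacency to the first root always produces the cut between a neighbourhood and its
  complement, whose monochromatic density 2/25 is optimal.\<close>

section \<open>The sampling spaces\<close>

text \<open>A vanishing triangle integral says nothing about parts of measure 0, where triangles may
  remain, so the induced graph on the roots is triangle-free only almost surely. This matters
  because \<open>U7\<close> sums over triangle-free types alone: averaging recovers the full
  \<open>d_mono W\<close> only if the weights \<open>type_prob\<close> add up to exactly 1. The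
  relabelling by a lexicographically least isomorphism is a definite description with no visible
  measurability. It becomes harmless because equal part vectors give equal induced graphs, hence the
  same relabelling. For the 5-cycle, 2/25 is 2 * 1 / 5^2: one edge must be deleted to make it
  bipartite, and the integral counts each edge in both orientations. A measurable colouring may
  split a part between both colours, so optimality has to be shown for fractional colourings, not
  only for the 32 colourings of the vertices. It is attained because the complement of a
  neighbourhood {k - 1, k + 1} is {k, k + 2, k + 3}, which spans a single edge.\<close>

lemma space_unit_leb [simp]: "space unit_leb = {0..1}"
  by (simp add: unit_leb_def)

interpretation unit_leb: prob_space unit_leb
  by (rule prob_spaceI) (simp add: unit_leb_def emeasure_restrict_space)

interpretation unit_square: prob_space "unit_leb \<Otimes>\<^sub>M unit_leb"
  using prob_space_pair[OF unit_leb.prob_space_axioms unit_leb.prob_space_axioms] .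

interpretation unit_cube: prob_space "unit_leb \<Otimes>\<^sub>M unit_leb \<Otimes>\<^sub>M unit_leb"
  using prob_space_pair[OF unit_leb.prob_space_axioms unit_square.prob_space_axioms] .

interpretation root_space: prob_space root_space
  unfolding root_space_def by (rule prob_space_PiM) (rule unit_leb.prob_space_axioms)

lemma space_root_space: "space root_space = {1..7} \<rightarrow>\<^sub>E {0..1}"
  by (simp add: root_space_def space_PiM)

lemma root_in:
  assumes "x \<in> space root_space" "i \<in> {1..7}"
  shows "x i \<in> {0..1}"
  using PiE_mem[of x "{1..7}" "\<lambda>_. {0..1}"] assms unfolding space_root_space .

lemma unit_square_rectangle:
  assumes "A \<in> sets unit_leb" "B \<in> sets unit_leb"
  shows "measure (unit_leb \<Otimes>\<^sub>M unit_leb) (A \<times> B) = measure unit_leb A * measure unit_leb B"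
  using unit_leb.emeasure_pair_measure_Times[OF assms]
  by (simp add: measure_def enn2real_mult)

lemma unit_cube_box:
  assumes "A \<in> sets unit_leb" "B \<in> sets unit_leb" "C \<in> sets unit_leb"
  shows "measure (unit_leb \<Otimes>\<^sub>M unit_leb \<Otimes>\<^sub>M unit_leb) (A \<times> B \<times> C) =
    measure unit_leb A * (measure unit_leb B * measure unit_leb C)"
proof -
  have "B \<times> C \<in> sets (unit_leb \<Otimes>\<^sub>M unit_leb)" using assms by auto
  from unit_square.emeasure_pair_measure_Times[OF assms(1) this]
  show ?thesis using unit_square_rectangle[OF assms(2,3)]
    by (simp add: measure_def enn2real_mult)
qed

lemma simple_graph_induced_graph:
  assumes "graphon W" "x \<in> space root_space"
  shows "simple_graph {1..7} (induced_graph W x)"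
proof -
  have "W (x i) (x j) = W (x j) (x i)" if "i \<in> {1..7}" "j \<in> {1..7}" for i j
  proof -
    have "x i \<in> {0..1}" "x j \<in> {0..1}" using that root_in[OF assms(2)] by blast+
    then show ?thesis using assms(1) unfolding graphon_def by blast
  qed
  then show ?thesis
    by (auto simp: simple_graph_def induced_graph_def sym_def irrefl_def)
qed

section \<open>Bounds on the cost of a colouring, valid for every graphon\<close>

text \<open>Supplies the lower bound without which the real infimum in \<open>d_mono\<close> would
  carry no information.\<close>

lemma mono_density_nonneg:
  assumes "graphon W"
  shows "0 \<le> mono_density W \<phi>"
  unfolding mono_density_def
  using assms by (intro integral_nonneg_AE AE_I2) (auto simp: space_pair_measure graphon_def)

lemma colouring_range:
  assumes "\<phi> \<in> colourings" "x \<in> {0..1}"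
  shows "\<phi> x \<in> {0, 1}"
  using measurable_space[of \<phi> unit_leb "count_space {0, 1}" x] assms
  unfolding colourings_def by simp

lemma d_mono_le:
  assumes "graphon W" "\<phi> \<in> colourings"
  shows "d_mono W \<le> mono_density W \<phi>"
  unfolding d_mono_def
  by (rule cINF_lower) (use assms mono_density_nonneg in \<open>auto intro!: bdd_belowI[of _ 0]\<close>)

text \<open>Stated for an arbitrary function \<open>\<phi>\<close>, so that the cost of a rule
  colouring can be dominated by 1 before its measurability is discussed.\<close>

lemma mono_density_le_1:
  assumes "graphon W"
  shows "mono_density W \<phi> \<le> 1"
proof (cases "integrable (unit_leb \<Otimes>\<^sub>M unit_leb)
    (\<lambda>(x, y). W x y * (if \<phi> x = \<phi> y then 1 else 0))")
  case True
  show ?thesis unfolding mono_density_def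
    using assms by (intro unit_square.integral_le_const[OF True] AE_I2)
      (auto simp: space_pair_measure graphon_def)
next
  \<comment> \<open>The Bochner integral of a non-integrable function has the default value
    0.\<close>
  case False
  then show ?thesis by (simp add: mono_density_def not_integrable_integral_eq)
qed

lemma lex_least_iso:
  assumes "\<exists>f. graph_iso f \<sigma> G"
  shows "graph_iso (lex_least_iso \<sigma> G) \<sigma> G"
  using theI'[OF lex_least_iso_exists] assms unfolding lex_least_iso_def by blast

lemma canonical_roots_in:
  assumes "x \<in> type_event W \<sigma>" "i \<in> {1..7}"
  shows "canonical_roots W \<sigma> x i \<in> {0..1}"
proof -
  have "lex_least_iso \<sigma> (induced_graph W x) permutes {1..7}"
    using assms(1) lex_least_iso unfolding type_event_def graph_iso_def by blast
  then have "lex_least_iso \<sigma> (induced_graph W x) i \<in> {1..7}"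
    using assms(2) permutes_in_image by metis
  moreover have "x \<in> space root_space" using assms(1) by (simp add: type_event_def)
  ultimately show ?thesis unfolding canonical_roots_def by (rule root_in[rotated])
qed

lemma finite_rules: "finite rules"
  by (simp add: rules_def finite_PiE)

lemma rules_nonempty: "rules \<noteq> {}"
  by (simp add: rules_def PiE_eq_empty_iff)

lemma finite_canonical_types:
  assumes "canonical_types T"
  shows "finite T"
proof (rule finite_subset)
  show "T \<subseteq> Pow ({1..7} \<times> {1..7})"
    using assms by (auto simp: canonical_types_def simple_graph_def)
qed simp

section \<open>Step graphons\<close>

locale zero_one_step =
  fixes W :: "real \<Rightarrow> real \<Rightarrow> real" and \<P> :: "real set set"
  assumes graphon: "graphon W"
    and finite_parts: "finite \<P>"
    and partition: "partition_on {0..1} \<P>"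
    and parts_sets: "\<P> \<subseteq> sets unit_leb"
    and const: "\<forall>A\<in>\<P>. \<forall>B\<in>\<P>. \<exists>c\<in>{0, 1}. \<forall>x\<in>A. \<forall>y\<in>B. W x y = c"
begin

section \<open>The part containing a point, and measurability of functions of the parts\<close>

definition part :: "real \<Rightarrow> real set" where
  "part x = (THE A. A \<in> \<P> \<and> x \<in> A)"

text \<open>The restriction to \<open>{1..7}\<close> makes \<open>parts x\<close> an element of the
  finite set \<open>{1..7} \<rightarrow>\<^sub>E \<P>\<close> for every root tuple \<open>x\<close>,
  and \<open>Pi\<^sub>E {1..7} (parts x)\<close> is then the box of all tuples with the same
  parts.\<close>

definition parts :: "(nat \<Rightarrow> real) \<Rightarrow> nat \<Rightarrow> real set" where
  "parts x = (\<lambda>i\<in>{1..7}. part (x i))"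

lemma part_eq:
  assumes "A \<in> \<P>" "x \<in> A"
  shows "part x = A"
  unfolding part_def
  using assms partition by (intro the_equality) (auto simp: partition_on_def disjoint_def)

lemma part_in:
  assumes "x \<in> {0..1}"
  shows "part x \<in> \<P>" "x \<in> part x"
proof -
  obtain A where "A \<in> \<P>" "x \<in> A" using assms partition unfolding partition_on_def by blast
  then show "part x \<in> \<P>" "x \<in> part x" using part_eq by simp_all
qed

lemma part_subset: "A \<in> \<P> \<Longrightarrow> A \<subseteq> {0..1}"
  using partition unfolding partition_on_def by blast

lemma W_cong:
  assumes "x \<in> {0..1}" "x' \<in> {0..1}" "y \<in> {0..1}" "y' \<in> {0..1}" "part x = part x'" "part y = part y'"
  shows "W x y = W x' y'"
proof -
  obtain c where "\<forall>a\<in>part x. \<forall>b\<in>part y. W a b = c" using const part_in assms by meson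
  moreover have "x \<in> part x" "x' \<in> part x" "y \<in> part y" "y' \<in> part y"
    using part_in assms by metis+
  ultimately show ?thesis by simp
qed

lemma W_01:
  assumes "x \<in> {0..1}" "y \<in> {0..1}"
  shows "W x y \<in> {0, 1}"
proof -
  obtain c where "c \<in> {0, 1}" "\<forall>a\<in>part x. \<forall>b\<in>part y. W a b = c"
    using const part_in assms by meson
  then show ?thesis using part_in assms by metis
qed

text \<open>A preimage under such an \<open>F\<close> is a union of parts, hence a finite union of
  measurable sets, whatever the target sigma-algebra is.\<close>

lemma measurable_of_part:
  assumes "\<And>x y. x \<in> {0..1} \<Longrightarrow> y \<in> {0..1} \<Longrightarrow> part x = part y \<Longrightarrow> F x = F y"
    and "F \<in> {0..1} \<rightarrow> space N"
  shows "F \<in> measurable unit_leb N"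
proof (rule measurableI)
  fix B assume "B \<in> sets N"
  let ?S = "F -` B \<inter> space unit_leb"
  have "?S = \<Union>(part ` ?S)"
  proof
    show "?S \<subseteq> \<Union>(part ` ?S)" using part_in(2) by auto
    show "\<Union>(part ` ?S) \<subseteq> ?S"
    proof
      fix y assume "y \<in> \<Union>(part ` ?S)"
      then obtain x where x: "x \<in> {0..1}" "F x \<in> B" "y \<in> part x" by auto
      then have "part y = part x" "y \<in> {0..1}"
        using part_eq part_in(1) part_subset by blast+
      then show "y \<in> ?S" using assms(1)[of y x] x by simp
    qed
  qed
  moreover have "finite (part ` ?S)"
    by (rule finite_subset[OF _ finite_parts]) (use part_in in auto)
  moreover have "part ` ?S \<subseteq> sets unit_leb" using part_in(1) parts_sets by auto
  ultimately show "?S \<in> sets unit_leb" using sets.finite_Union by metis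
qed (use assms(2) in auto)

text \<open>The same argument on the root space, with finitely many boxes of parts instead of parts.
  All measurability in the roots, for type events and for costs, comes from here.\<close>

lemma measurable_of_parts:
  assumes "\<And>x y. x \<in> space root_space \<Longrightarrow> y \<in> space root_space \<Longrightarrow> parts x = parts y \<Longrightarrow> F x = F y"
    and "F \<in> space root_space \<rightarrow> space N"
  shows "F \<in> measurable root_space N"
proof (rule measurableI)
  fix B assume "B \<in> sets N"
  let ?S = "F -` B \<inter> space root_space"
  have "?S = (\<Union>k\<in>parts ` ?S. Pi\<^sub>E {1..7} k)"
  proof
    have "x \<in> Pi\<^sub>E {1..7} (parts x)" if "x \<in> ?S" for x
      using that part_in(2) by (auto simp: space_root_space parts_def PiE_iff)
    then show "?S \<subseteq> (\<Union>k\<in>parts ` ?S. Pi\<^sub>E {1..7} k)" by blast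
    show "(\<Union>k\<in>parts ` ?S. Pi\<^sub>E {1..7} k) \<subseteq> ?S"
    proof
      fix y assume "y \<in> (\<Union>k\<in>parts ` ?S. Pi\<^sub>E {1..7} k)"
      then obtain x where x: "x \<in> space root_space" "F x \<in> B" and y: "y \<in> Pi\<^sub>E {1..7} (parts x)"
        by auto
      have eq: "part (y i) = part (x i) \<and> y i \<in> {0..1}" if i: "i \<in> {1..7}" for i
      proof -
        have "y i \<in> part (x i)" using PiE_mem[OF y i] i by (simp add: parts_def)
        moreover have "part (x i) \<in> \<P>" using part_in(1) root_in[OF x(1) i] .
        ultimately show ?thesis using part_eq part_subset by blast
      qed
      have "y \<in> space root_space" using eq y by (auto simp: space_root_space PiE_iff)
      moreover have "parts y = parts x"
        unfolding parts_def by (rule restrict_ext) (use eq in blast)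
      ultimately show "y \<in> ?S" using assms(1)[of y x] x by simp
    qed
  qed
  moreover have "finite (parts ` ?S)"
  proof (rule finite_subset)
    show "parts ` ?S \<subseteq> {1..7} \<rightarrow>\<^sub>E \<P>"
    proof (rule image_subsetI)
      fix x assume "x \<in> ?S"
      then have "part (x i) \<in> \<P>" if "i \<in> {1..7}" for i
        using part_in(1) root_in that by blast
      then show "parts x \<in> {1..7} \<rightarrow>\<^sub>E \<P>"
        unfolding parts_def by (rule restrict_PiE_iff[THEN iffD2, OF ballI])
    qed
  qed (simp add: finite_parts finite_PiE)
  moreover have "Pi\<^sub>E {1..7} k \<in> sets root_space" if k: "k \<in> parts ` ?S" for k
    unfolding root_space_def
  proof (rule sets_PiM_I_finite)
    fix i :: nat assume i: "i \<in> {1..7}"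
    obtain x where x: "x \<in> space root_space" "k = parts x" using k by blast
    have "part (x i) \<in> \<P>" using part_in(1) root_in[OF x(1) i] .
    then show "k i \<in> sets unit_leb" using x(2) i parts_sets by (auto simp: parts_def)
  qed simp
  ultimately show "?S \<in> sets root_space" using sets.finite_UN by metis
qed (use assms(2) in auto)

section \<open>Types and rule colourings depend on the roots only through their parts\<close>

lemma parts_component:
  assumes "parts x = parts y" "i \<in> {1..7}"
  shows "part (x i) = part (y i)"
  using fun_cong[OF assms(1), of i] assms(2) by (simp add: parts_def)

lemma induced_graph_cong:
  assumes "x \<in> space root_space" "y \<in> space root_space" "parts x = parts y"
  shows "induced_graph W x = induced_graph W y"
proof -
  have "W (x i) (x j) = W (y i) (y j)" if "i \<in> {1..7}" "j \<in> {1..7}" for i j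
    using assms that by (intro W_cong parts_component root_in)
  then show ?thesis unfolding induced_graph_def by auto
qed

lemma type_event_sets: "type_event W \<sigma> \<in> sets root_space"
proof -
  have "(\<lambda>x. \<exists>f. graph_iso f \<sigma> (induced_graph W x)) \<in> measurable root_space (count_space UNIV)"
  proof (rule measurable_of_parts)
    fix x y assume "x \<in> space root_space" "y \<in> space root_space" "parts x = parts y"
    then show "(\<exists>f. graph_iso f \<sigma> (induced_graph W x)) = (\<exists>f. graph_iso f \<sigma> (induced_graph W y))"
      using induced_graph_cong[of x y] by simp
  qed simp
  then show ?thesis unfolding type_event_def pred_def[symmetric] by measurable
qed

lemma profile_in:
  assumes "v \<in> {0..1}" "\<And>i. i \<in> {1..7} \<Longrightarrow> r i \<in> {0..1}"
  shows "profile W r v \<in> {1..7} \<rightarrow>\<^sub>E {0, 1}"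
  using W_01 assms by (auto simp: profile_def)

lemma rule_colouring_in_colourings:
  assumes "c \<in> rules" "x \<in> type_event W \<sigma>"
  shows "rule_colouring W \<sigma> x c \<in> colourings"
  unfolding colourings_def
proof (rule measurable_of_part)
  fix v w :: real assume vw: "v \<in> {0..1}" "w \<in> {0..1}" "part v = part w"
  have "profile W (canonical_roots W \<sigma> x) v = profile W (canonical_roots W \<sigma> x) w"
    unfolding profile_def
    by (intro restrict_ext W_cong vw canonical_roots_in[OF assms(2)] refl)
  then show "rule_colouring W \<sigma> x c v = rule_colouring W \<sigma> x c w"
    by (simp add: rule_colouring_def)
next
  show "rule_colouring W \<sigma> x c \<in> {0..1} \<rightarrow> space (count_space {0, 1})"
  proof
    fix v :: real assume "v \<in> {0..1}"
    then have "profile W (canonical_roots W \<sigma> x) v \<in> {1..7} \<rightarrow>\<^sub>E {0, 1}"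
      using canonical_roots_in[OF assms(2)] by (intro profile_in)
    from PiE_mem[OF assms(1)[unfolded rules_def] this]
    have "c (profile W (canonical_roots W \<sigma> x) v) \<in> {0, 1}" .
    then show "rule_colouring W \<sigma> x c v \<in> space (count_space {0, 1})"
      by (simp add: rule_colouring_def)
  qed
qed

text \<open>Equal parts give the same induced graph and so the same relabelling, and
  \<open>W v\<close> does not distinguish roots in one part; the two colourings therefore agree on
  the unit interval. Membership in the type event ensures that the relabelling is a genuine
  permutation, so that relabelled indices stay in \<open>{1..7}\<close>.\<close>

lemma mono_density_rule_colouring_cong:
  assumes "x \<in> type_event W \<sigma>" "y \<in> space root_space" "parts x = parts y"
  shows "mono_density W (rule_colouring W \<sigma> x c) = mono_density W (rule_colouring W \<sigma> y c)"
proof -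
  have x: "x \<in> space root_space" using assms(1) by (simp add: type_event_def)
  note G = induced_graph_cong[OF x assms(2,3)]
  have perm: "lex_least_iso \<sigma> (induced_graph W x) permutes {1..7}"
    using assms(1) lex_least_iso unfolding type_event_def graph_iso_def by blast
  have "profile W (canonical_roots W \<sigma> x) v = profile W (canonical_roots W \<sigma> y) v"
    if v: "v \<in> {0..1}" for v
    unfolding profile_def
  proof (rule restrict_ext)
    fix i :: nat assume "i \<in> {1..7}"
    then have j: "lex_least_iso \<sigma> (induced_graph W x) i \<in> {1..7}" (is "?j \<in> _")
      using perm permutes_in_image by metis
    have "W v (x ?j) = W v (y ?j)"
      by (rule W_cong[OF v v root_in[OF x j] root_in[OF assms(2) j] refl
            parts_component[OF assms(3) j]])
    then show "W v (canonical_roots W \<sigma> x i) = W v (canonical_roots W \<sigma> y i)"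
      by (simp add: canonical_roots_def G)
  qed
  then have "rule_colouring W \<sigma> x c v = rule_colouring W \<sigma> y c v" if "v \<in> {0..1}" for v
    using that by (simp add: rule_colouring_def)
  then show ?thesis
    unfolding mono_density_def
    by (intro Bochner_Integration.integral_cong) (auto simp: space_pair_measure)
qed

lemma set_integrable_cost:
  "set_integrable root_space (type_event W \<sigma>) (\<lambda>x. mono_density W (rule_colouring W \<sigma> x c))"
proof -
  \<comment> \<open>Outside the type event no isomorphism exists and \<open>lex_least_iso\<close> is
    unspecified; the indicator removes these tuples.\<close>
  let ?f = "\<lambda>x. indicator (type_event W \<sigma>) x *\<^sub>R mono_density W (rule_colouring W \<sigma> x c)"
  have "?f \<in> borel_measurable root_space"
  proof (rule measurable_of_parts)
    fix x y assume xy: "x \<in> space root_space" "y \<in> space root_space" "parts x = parts y"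
    have "x \<in> type_event W \<sigma> \<longleftrightarrow> y \<in> type_event W \<sigma>"
      using xy induced_graph_cong[OF xy] by (simp add: type_event_def)
    then show "?f x = ?f y"
      using mono_density_rule_colouring_cong[OF _ xy(2,3)] by (simp add: indicator_def)
  qed simp
  moreover have "\<bar>mono_density W \<phi>\<bar> \<le> 1" for \<phi>
    using mono_density_nonneg[OF graphon, of \<phi>] mono_density_le_1[OF graphon, of \<phi>] by simp
  ultimately show ?thesis
    unfolding set_integrable_def
    by (intro root_space.integrable_const_bound[of _ 1]) (auto simp: indicator_def)
qed

text \<open>The weight \<open>type_prob W \<sigma>\<close> is kept on both sides: a type of
  probability 0 has a \<open>cond_cost\<close> that is a division by 0, and only the weighted
  inequality is true for it.\<close>

lemma type_prob_d_mono_le: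
  "type_prob W \<sigma> * d_mono W \<le> type_prob W \<sigma> * (MIN c\<in>rules. cond_cost W \<sigma> c)"
proof (cases "type_prob W \<sigma> = 0")
  case False
  then have pos: "type_prob W \<sigma> > 0" by (simp add: type_prob_def measure_nonneg less_le)
  have "d_mono W \<le> cond_cost W \<sigma> c" if c: "c \<in> rules" for c
  proof -
    have const: "set_integrable root_space (type_event W \<sigma>) (\<lambda>x. d_mono W)"
      unfolding set_integrable_def
      by (intro integrable_mult_indicator type_event_sets) simp
    have "d_mono W * type_prob W \<sigma> = (LINT x:type_event W \<sigma>|root_space. d_mono W)"
      using type_event_sets[of \<sigma>] by (simp add: type_prob_def set_lebesgue_integral_def)
    also have "\<dots> \<le> (LINT x:type_event W \<sigma>|root_space. mono_density W (rule_colouring W \<sigma> x c))"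
      by (intro set_integral_mono const set_integrable_cost d_mono_le graphon
          rule_colouring_in_colourings c)
    finally show ?thesis using pos by (simp add: cond_cost_def le_divide_eq)
  qed
  then have "d_mono W \<le> (MIN c\<in>rules. cond_cost W \<sigma> c)"
    using finite_rules rules_nonempty by (intro Min.boundedI) auto
  then show ?thesis using pos by (intro mult_left_mono) auto
qed simp

text \<open>Since \<open>W\<close> is constant on products of parts, one triangle makes the
  integrand 1 on all of \<open>A \<times> B \<times> C\<close>. The integral is then at least the
  product of the three positive measures. The parts may coincide.\<close>

lemma triangle_free_parts:
  assumes "triangle_free_graphon W" "A \<in> \<P>" "B \<in> \<P>" "C \<in> \<P>"
    and pos: "measure unit_leb A > 0" "measure unit_leb B > 0" "measure unit_leb C > 0"
    and mem: "x \<in> A" "y \<in> B" "z \<in> C"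
  shows "\<not> (W x y = 1 \<and> W y z = 1 \<and> W x z = 1)"
proof
  assume W1: "W x y = 1 \<and> W y z = 1 \<and> W x z = 1"
  let ?M = "unit_leb \<Otimes>\<^sub>M unit_leb \<Otimes>\<^sub>M unit_leb"
  let ?f = "\<lambda>(x, y, z). W x y * W y z * W x z"
  have meas: "(\<lambda>(x, y). W x y) \<in> borel_measurable (unit_leb \<Otimes>\<^sub>M unit_leb)"
    using graphon by (simp add: graphon_def)
  have "(\<lambda>p. (\<lambda>(x, y). W x y) (fst p, fst (snd p)) * (\<lambda>(x, y). W x y) (snd p) *
      (\<lambda>(x, y). W x y) (fst p, snd (snd p))) \<in> borel_measurable ?M"
    by (intro borel_measurable_times measurable_compose[OF _ meas]) measurable
  then have f_meas: "?f \<in> borel_measurable ?M" by (simp add: case_prod_beta')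
  have W_unit: "0 \<le> W a b \<and> W a b \<le> 1" if "a \<in> {0..1}" "b \<in> {0..1}" for a b
    using W_01[OF that] by auto
  have "integrable ?M ?f"
    using f_meas by (intro unit_cube.integrable_const_bound[of _ 1] AE_I2)
      (auto simp: space_pair_measure abs_mult W_unit intro!: mult_le_one)
  moreover have sets: "A \<in> sets unit_leb" "B \<in> sets unit_leb" "C \<in> sets unit_leb"
    using assms parts_sets by auto
  then have box: "A \<times> B \<times> C \<in> sets ?M" by auto
  moreover have "indicator (A \<times> B \<times> C) p \<le> ?f p" if "p \<in> space ?M" for p
  proof (cases "p \<in> A \<times> B \<times> C")
    case True
    then obtain a b c where p: "p = (a, b, c)" "a \<in> A" "b \<in> B" "c \<in> C" by auto
    have unit: "a \<in> {0..1}" "b \<in> {0..1}" "c \<in> {0..1}" "x \<in> {0..1}" "y \<in> {0..1}" "z \<in> {0..1}"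
      using p mem part_subset assms(2-4) by blast+
    have eq: "part a = part x" "part b = part y" "part c = part z"
      using part_eq p mem assms(2-4) by metis+
    have "W a b = W x y" "W b c = W y z" "W a c = W x z"
      by (intro W_cong unit eq)+
    then show ?thesis using W1 p by simp
  next
    case False
    then show ?thesis using that by (auto simp: space_pair_measure W_unit)
  qed
  ultimately have "measure ?M (A \<times> B \<times> C) \<le> integral\<^sup>L ?M ?f"
    using integral_mono[of ?M "indicator (A \<times> B \<times> C)" ?f]
    by (simp add: unit_cube.emeasure_eq_measure)
  also have "\<dots> = 0" using assms(1) by (simp add: triangle_free_graphon_def)
  finally show False using unit_cube_box[OF sets] pos
    by (simp add: mult_le_0_iff)
qed

text \<open>The null parts are finitely many, so their union is a null set, and each of the seven
  roots avoids it almost surely.\<close>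

lemma AE_root_parts_positive:
  "AE x in root_space. \<forall>i\<in>{1..7}. measure unit_leb (part (x i)) > 0"
proof -
  have AE1: "AE v in unit_leb. measure unit_leb (part v) > 0"
  proof (rule AE_I')
    show "(\<Union>A\<in>{A\<in>\<P>. measure unit_leb A = 0}. A) \<in> null_sets unit_leb"
      using finite_parts parts_sets
      by (intro null_sets_UN' countable_finite)
         (auto simp: unit_leb.emeasure_eq_measure intro!: null_setsI)
    show "{v \<in> space unit_leb. \<not> 0 < measure unit_leb (part v)} \<subseteq>
        (\<Union>A\<in>{A\<in>\<P>. measure unit_leb A = 0}. A)"
      using part_in by (auto simp: not_less measure_le_0_iff)
  qed
  show ?thesis
    unfolding root_space_def
    by (intro AE_finite_allI AE_PiM_component unit_leb.prob_space_axioms AE1) auto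
qed

lemma AE_induced_graph_triangle_free:
  assumes "triangle_free_graphon W"
  shows "AE x in root_space. triangle_free_graph (induced_graph W x)"
  using AE_space AE_root_parts_positive
proof eventually_elim
  fix x assume x: "x \<in> space root_space" "\<forall>i\<in>{1..7}. measure unit_leb (part (x i)) > 0"
  have part: "part (x i) \<in> \<P>" "x i \<in> part (x i)" if "i \<in> {1..7}" for i
    using part_in[OF root_in[OF x(1) that]] .
  have "\<not> (W (x i) (x j) = 1 \<and> W (x j) (x k) = 1 \<and> W (x i) (x k) = 1)"
    if "i \<in> {1..7}" "j \<in> {1..7}" "k \<in> {1..7}" for i j k
    using triangle_free_parts[OF assms part(1) part(1) part(1) _ _ _ part(2) part(2) part(2)] that x(2)
    by blast
  then show "triangle_free_graph (induced_graph W x)"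
    unfolding triangle_free_graph_def induced_graph_def by blast
qed

text \<open>Almost every tuple induces a triangle-free graph and so lies in exactly one type event:
  the indicators sum to 1 almost everywhere. This is how triangle-freeness enters the bound;
  otherwise mass would be lost to graphs that have no type in \<open>T\<close>.\<close>

lemma sum_type_prob:
  assumes T: "canonical_types T" and "triangle_free_graphon W"
  shows "(\<Sum>\<sigma>\<in>T. type_prob W \<sigma>) = 1"
proof -
  have fin: "finite T" using finite_canonical_types[OF T] .
  have "(\<Sum>\<sigma>\<in>T. type_prob W \<sigma>) = (\<Sum>\<sigma>\<in>T. LINT x|root_space. indicator (type_event W \<sigma>) x)"
    using type_event_sets by (simp add: type_prob_def)
  also have "\<dots> = (LINT x|root_space. (\<Sum>\<sigma>\<in>T. indicator (type_event W \<sigma>) x))"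
    using type_event_sets
    by (intro Bochner_Integration.integral_sum[symmetric] integrable_real_indicator)
       (simp_all add: root_space.emeasure_eq_measure)
  also have "\<dots> = (LINT x|root_space. 1)"
  proof (rule integral_cong_AE)
    show "AE x in root_space. (\<Sum>\<sigma>\<in>T. indicator (type_event W \<sigma>) x) = (1::real)"
      using AE_induced_graph_triangle_free[OF assms(2)] AE_space
    proof eventually_elim
      fix x assume x: "triangle_free_graph (induced_graph W x)" "x \<in> space root_space"
      then have "\<exists>!\<sigma>. \<sigma> \<in> T \<and> (\<exists>f. graph_iso f \<sigma> (induced_graph W x))"
        using T simple_graph_induced_graph[OF graphon] unfolding canonical_types_def by blast
      then obtain \<sigma> where "\<sigma> \<in> T"
        "\<And>\<tau>. \<tau> \<in> T \<Longrightarrow> (\<exists>f. graph_iso f \<tau> (induced_graph W x)) \<longleftrightarrow> \<tau> = \<sigma>"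
        by auto
      then have "(\<Sum>\<tau>\<in>T. indicator (type_event W \<tau>) x) = (\<Sum>\<tau>\<in>T. if \<tau> = \<sigma> then 1 else 0 :: real)"
        using x(2) by (intro sum.cong) (auto simp: type_event_def indicator_def)
      then show "(\<Sum>\<sigma>\<in>T. indicator (type_event W \<sigma>) x) = (1::real)"
        using fin \<open>\<sigma> \<in> T\<close> by simp
    qed
  qed (use type_event_sets in measurable)
  finally show ?thesis by (simp add: root_space.prob_space)
qed

lemma d_mono_le_U7:
  assumes "canonical_types T" "triangle_free_graphon W"
  shows "d_mono W \<le> U7 T W"
proof -
  have "d_mono W = (\<Sum>\<sigma>\<in>T. type_prob W \<sigma> * d_mono W)"
    unfolding sum_distrib_right[symmetric] sum_type_prob[OF assms] by simp
  also have "\<dots> \<le> U7 T W"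
    unfolding U7_def by (rule sum_mono) (rule type_prob_d_mono_le)
  finally show ?thesis .
qed

end

section \<open>Graphons of finite graphs\<close>

locale graph_graphon =
  fixes V :: "'v set" and E :: "('v \<times> 'v) set" and W :: "real \<Rightarrow> real \<Rightarrow> real"
    and P :: "'v \<Rightarrow> real set"
  assumes graph: "simple_graph V E"
    and triangle_free: "triangle_free_graph E"
    and disjoint: "disjoint_family_on P V"
    and cover: "(\<Union>v\<in>V. P v) = {0..1}"
    and P_sets: "v \<in> V \<Longrightarrow> P v \<in> sets unit_leb"
    and P_measure: "v \<in> V \<Longrightarrow> measure unit_leb (P v) = 1 / card V"
    and W_eq: "\<lbrakk>u \<in> V; v \<in> V; x \<in> P u; y \<in> P v\<rbrakk> \<Longrightarrow> W x y = (if (u, v) \<in> E then 1 else 0)"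
begin

lemma finite_V: "finite V"
  using graph by (simp add: simple_graph_def)

lemma obtain_vertex:
  assumes "x \<in> {0..1}"
  obtains v where "v \<in> V" "x \<in> P v"
  using assms cover by blast

lemma P_subset: "v \<in> V \<Longrightarrow> P v \<subseteq> {0..1}"
  using cover by blast

lemma mem_P_iff:
  assumes "u \<in> V" "v \<in> V" "x \<in> P u"
  shows "x \<in> P v \<longleftrightarrow> u = v"
  using assms disjoint by (auto simp: disjoint_family_on_def)

lemma graphon: "graphon W"
proof -
  have "W x y \<in> {0..1} \<and> W x y = W y x" if xy: "x \<in> {0..1}" "y \<in> {0..1}" for x y
  proof -
    obtain u where u: "u \<in> V" "x \<in> P u" using obtain_vertex xy(1) .
    obtain v where v: "v \<in> V" "y \<in> P v" using obtain_vertex xy(2) .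
    have "(u, v) \<in> E \<longleftrightarrow> (v, u) \<in> E"
      using graph by (auto simp: simple_graph_def sym_def)
    then show ?thesis using W_eq[OF u(1) v(1) u(2) v(2)] W_eq[OF v(1) u(1) v(2) u(2)] by simp
  qed
  moreover have "(\<lambda>(x, y). W x y) \<in> borel_measurable (unit_leb \<Otimes>\<^sub>M unit_leb)"
  proof -
    \<comment> \<open>On the square \<open>W\<close> is this finite combination of indicators of
      measurable rectangles.\<close>
    let ?g = "\<lambda>p. \<Sum>u\<in>V. \<Sum>v\<in>V. (if (u, v) \<in> E then 1 else 0) * indicator (P u \<times> P v) p :: real"
    have "?g p = (case p of (x, y) \<Rightarrow> W x y)" if "p \<in> space (unit_leb \<Otimes>\<^sub>M unit_leb)" for p
    proof -
      obtain x y where p: "p = (x, y)" "x \<in> {0..1}" "y \<in> {0..1}"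
        using \<open>p \<in> _\<close> by (auto simp: space_pair_measure)
      obtain a where a: "a \<in> V" "x \<in> P a" using obtain_vertex p(2) .
      obtain b where b: "b \<in> V" "y \<in> P b" using obtain_vertex p(3) .
      note ab = a b
      have mem: "x \<in> P v \<longleftrightarrow> v = a" "y \<in> P v \<longleftrightarrow> v = b" if "v \<in> V" for v
        using mem_P_iff[OF a(1) that a(2)] mem_P_iff[OF b(1) that b(2)] by blast+
      have Wxy: "W x y = (if (a, b) \<in> E then 1 else 0)" using W_eq ab by blast
      have "?g p = (\<Sum>u\<in>V. \<Sum>v\<in>V. if u = a then if v = b then W x y else 0 else 0)"
        by (intro sum.cong refl) (auto simp: p mem indicator_def Wxy)
      also have "\<dots> = (\<Sum>u\<in>V. if u = a then (\<Sum>v\<in>V. if v = b then W x y else 0) else 0)"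
        by (intro sum.cong refl) auto
      also have "\<dots> = W x y" using ab finite_V by simp
      finally show ?thesis by (simp add: p)
    qed
    moreover have "?g \<in> borel_measurable (unit_leb \<Otimes>\<^sub>M unit_leb)"
      using P_sets by (intro borel_measurable_sum borel_measurable_times borel_measurable_indicator)
        auto
    ultimately show ?thesis using measurable_cong by (metis (no_types, lifting))
  qed
  ultimately show ?thesis unfolding graphon_def by blast
qed

sublocale zero_one_step W "P ` V"
proof
  show "partition_on {0..1} (P ` V)"
    unfolding partition_on_def
  proof (intro conjI)
    \<comment> \<open>\<open>partition_on\<close> forbids empty blocks; here each has the positive
      measure \<open>1 / card V\<close>.\<close>
    have "P v \<noteq> {}" if "v \<in> V" for v
      using P_measure[OF that] finite_V that by auto
    then show "{} \<notin> P ` V" by auto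
    show "disjoint (P ` V)" using disjoint by (rule disjoint_family_on_disjoint_image)
  qed (use cover in auto)
  show "\<forall>A\<in>P ` V. \<forall>B\<in>P ` V. \<exists>c\<in>{0, 1}. \<forall>x\<in>A. \<forall>y\<in>B. W x y = c"
    using W_eq by force
qed (use graphon finite_V P_sets in auto)

lemma triangle_free_graphon: "triangle_free_graphon W"
proof -
  have "W x y * W y z * W x z = 0" if xyz: "x \<in> {0..1}" "y \<in> {0..1}" "z \<in> {0..1}" for x y z
  proof -
    obtain u where u: "u \<in> V" "x \<in> P u" using obtain_vertex xyz(1) .
    obtain v where v: "v \<in> V" "y \<in> P v" using obtain_vertex xyz(2) .
    obtain w where w: "w \<in> V" "z \<in> P w" using obtain_vertex xyz(3) .
    have "\<not> ((u, v) \<in> E \<and> (v, w) \<in> E \<and> (u, w) \<in> E)"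
      using triangle_free by (auto simp: triangle_free_graph_def)
    then show ?thesis
      using W_eq[OF u(1) v(1) u(2) v(2)] W_eq[OF v(1) w(1) v(2) w(2)] W_eq[OF u(1) w(1) u(2) w(2)]
      by auto
  qed
  then have "(LINT (x, y, z)|(unit_leb \<Otimes>\<^sub>M unit_leb \<Otimes>\<^sub>M unit_leb). W x y * W y z * W x z) =
      (LINT p|(unit_leb \<Otimes>\<^sub>M unit_leb \<Otimes>\<^sub>M unit_leb). 0)"
    by (intro Bochner_Integration.integral_cong) (auto simp: space_pair_measure)
  then show ?thesis by (simp add: triangle_free_graphon_def)
qed

section \<open>Monochromatic density as a quadratic form in the measures of the colour
  classes\<close>

lemma colour_class_sets:
  assumes "\<phi> \<in> colourings" "v \<in> V"
  shows "P v \<inter> \<phi> -` {b} \<in> sets unit_leb"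
proof -
  \<comment> \<open>In \<open>count_space {0, 1}\<close> only subsets of \<open>{0, 1}\<close> are
    measurable, and \<open>\<phi>\<close> is arbitrary off the unit interval; hence both
    intersections.\<close>
  have "\<phi> -` ({b} \<inter> {0, 1}) \<inter> space unit_leb \<in> sets unit_leb"
    using assms(1) unfolding colourings_def by (rule measurable_sets) simp
  moreover have "P v \<inter> \<phi> -` {b} = P v \<inter> (\<phi> -` ({b} \<inter> {0, 1}) \<inter> space unit_leb)"
    using P_subset[OF assms(2)] colouring_range[OF assms(1)] by auto
  ultimately show ?thesis using P_sets[OF assms(2)] by (metis sets.Int)
qed

text \<open>Only how much of each part gets each colour matters, so minimising over measurable
  colourings becomes a finite-dimensional problem.\<close>

lemma mono_density_eq:
  assumes "\<phi> \<in> colourings"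
  shows "mono_density W \<phi> = (\<Sum>u\<in>V. \<Sum>v\<in>V. if (u, v) \<in> E then
    (\<Sum>b\<in>{0, 1}. measure unit_leb (P u \<inter> \<phi> -` {b}) * measure unit_leb (P v \<inter> \<phi> -` {b})) else 0)"
proof -
  let ?R = "\<lambda>u v b. (P u \<inter> \<phi> -` {b}) \<times> (P v \<inter> \<phi> -` {b})"
  let ?e = "\<lambda>u v. (if (u, v) \<in> E then 1 else 0) :: real"
  have sets: "?R u v b \<in> sets (unit_leb \<Otimes>\<^sub>M unit_leb)" if "u \<in> V" "v \<in> V" for u v b
    using that colour_class_sets[OF assms] by auto
  have eq: "(case p of (x, y) \<Rightarrow> W x y * (if \<phi> x = \<phi> y then 1 else 0)) =
      (\<Sum>u\<in>V. \<Sum>v\<in>V. \<Sum>b\<in>{0, 1}. ?e u v * indicator (?R u v b) p)"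
    if "p \<in> space (unit_leb \<Otimes>\<^sub>M unit_leb)" for p
  proof -
    obtain x y where p: "p = (x, y)" "x \<in> {0..1}" "y \<in> {0..1}"
      using \<open>p \<in> _\<close> by (auto simp: space_pair_measure)
    have \<phi>: "\<phi> x \<in> {0, 1}"
      using colouring_range[OF assms p(2)] .
    obtain a where a: "a \<in> V" "x \<in> P a" using obtain_vertex p(2) .
    obtain b where b: "b \<in> V" "y \<in> P b" using obtain_vertex p(3) .
    note ab = a b
    have mem: "x \<in> P v \<longleftrightarrow> v = a" "y \<in> P v \<longleftrightarrow> v = b" if "v \<in> V" for v
      using mem_P_iff[OF a(1) that a(2)] mem_P_iff[OF b(1) that b(2)] by blast+
    have Wxy: "W x y = (if (a, b) \<in> E then 1 else 0)" using W_eq ab by blast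
    let ?r = "W x y * (if \<phi> x = \<phi> y then 1 else 0)"
    \<comment> \<open>At a point of the square only the pair of parts containing it contributes, and
      of the two colours only \<open>\<phi> x\<close>, provided that \<open>\<phi> y\<close>
      agrees.\<close>
    have summand: "(\<Sum>d\<in>{0, 1}. ?e u v * indicator (?R u v d) p) =
        (if u = a then if v = b then ?r else 0 else 0)" if "u \<in> V" "v \<in> V" for u v
      using that \<phi> by (auto simp: p mem indicator_def Wxy)
    have "(\<Sum>u\<in>V. \<Sum>v\<in>V. \<Sum>d\<in>{0, 1}. ?e u v * indicator (?R u v d) p) =
        (\<Sum>u\<in>V. \<Sum>v\<in>V. if u = a then if v = b then ?r else 0 else 0)"
      by (intro sum.cong refl summand)
    also have "\<dots> = (\<Sum>u\<in>V. if u = a then (\<Sum>v\<in>V. if v = b then ?r else 0) else 0)"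
      by (intro sum.cong refl) auto
    also have "\<dots> = ?r" using ab finite_V by simp
    finally show ?thesis by (simp add: p)
  qed
  have int: "integrable (unit_leb \<Otimes>\<^sub>M unit_leb) (\<lambda>p. ?e u v * indicator (?R u v b) p)"
    if "u \<in> V" "v \<in> V" for u v b
    using sets[OF that, of b]
    by (intro integrable_mult_right integrable_real_indicator)
       (simp_all add: unit_square.emeasure_eq_measure)
  have "mono_density W \<phi> = (LINT p|(unit_leb \<Otimes>\<^sub>M unit_leb).
      (\<Sum>u\<in>V. \<Sum>v\<in>V. \<Sum>b\<in>{0, 1}. ?e u v * indicator (?R u v b) p))"
    unfolding mono_density_def by (intro Bochner_Integration.integral_cong eq refl)
  also have "\<dots> = (\<Sum>u\<in>V.
      LINT p|(unit_leb \<Otimes>\<^sub>M unit_leb). (\<Sum>v\<in>V. \<Sum>b\<in>{0, 1}. ?e u v * indicator (?R u v b) p))"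
    by (intro sum.cong refl Bochner_Integration.integral_sum Bochner_Integration.integrable_sum int)
  also have "\<dots> = (\<Sum>u\<in>V. \<Sum>v\<in>V.
      LINT p|(unit_leb \<Otimes>\<^sub>M unit_leb). (\<Sum>b\<in>{0, 1}. ?e u v * indicator (?R u v b) p))"
    by (intro sum.cong refl Bochner_Integration.integral_sum Bochner_Integration.integrable_sum int)
  also have "\<dots> = (\<Sum>u\<in>V. \<Sum>v\<in>V. \<Sum>b\<in>{0, 1}.
      LINT p|(unit_leb \<Otimes>\<^sub>M unit_leb). ?e u v * indicator (?R u v b) p)"
    by (intro sum.cong refl Bochner_Integration.integral_sum Bochner_Integration.integrable_sum int)
  also have "\<dots> = (\<Sum>u\<in>V. \<Sum>v\<in>V. \<Sum>b\<in>{0, 1}. ?e u v *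
      (measure unit_leb (P u \<inter> \<phi> -` {b}) * measure unit_leb (P v \<inter> \<phi> -` {b})))"
    using sets unit_square_rectangle colour_class_sets[OF assms]
    by (intro sum.cong refl) simp
  also have "\<dots> = (\<Sum>u\<in>V. \<Sum>v\<in>V. if (u, v) \<in> E then
    (\<Sum>b\<in>{0, 1}. measure unit_leb (P u \<inter> \<phi> -` {b}) * measure unit_leb (P v \<inter> \<phi> -` {b})) else 0)"
    by (intro sum.cong refl) auto
  finally show ?thesis .
qed

lemma colour_class_measure:
  assumes "\<phi> \<in> colourings" "v \<in> V"
  shows "measure unit_leb (P v \<inter> \<phi> -` {0}) + measure unit_leb (P v \<inter> \<phi> -` {1}) = 1 / card V"
proof -
  have "P v = (P v \<inter> \<phi> -` {0}) \<union> (P v \<inter> \<phi> -` {1})"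
    using P_subset[OF assms(2)] colouring_range[OF assms(1)] by blast
  then have "measure unit_leb (P v) =
      measure unit_leb ((P v \<inter> \<phi> -` {0}) \<union> (P v \<inter> \<phi> -` {1}))" by (rule arg_cong)
  also have "\<dots> = measure unit_leb (P v \<inter> \<phi> -` {0}) + measure unit_leb (P v \<inter> \<phi> -` {1})"
    using colour_class_sets[OF assms] by (intro unit_leb.finite_measure_Union) auto
  finally show ?thesis using P_measure[OF assms(2)] by simp
qed

end

lemma graph_graphonI:
  assumes "simple_graph V E" "triangle_free_graph E" "is_graph_graphon V E W"
  obtains P where "graph_graphon V E W P"
proof -
  obtain P where P: "disjoint_family_on P V \<and> (\<Union>v\<in>V. P v) = {0..1} \<and>
      (\<forall>v\<in>V. P v \<in> sets unit_leb \<and> measure unit_leb (P v) = 1 / card V) \<and>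
      (\<forall>u\<in>V. \<forall>v\<in>V. \<forall>x\<in>P u. \<forall>y\<in>P v. W x y = (if (u, v) \<in> E then 1 else 0))"
    using assms(3) unfolding is_graph_graphon_def by (rule exE)
  have "graph_graphon V E W P"
    by (rule graph_graphon.intro) (use assms(1,2) P in simp_all)
  then show thesis by (rule that)
qed

section \<open>The 5-cycle\<close>

lemma C5_edges_eq:
  "C5_edges = {(0, 1), (1, 0), (1, 2), (2, 1), (2, 3), (3, 2), (3, 4), (4, 3), (4, 0), (0, 4)}"
proof -
  have "C5_edges = (\<Union>i\<in>{..<5}. {(i, (i + 1) mod 5), ((i + 1) mod 5, i)})"
    by (auto simp: C5_edges_def)
  moreover have "{..<5 :: nat} = {0, 1, 2, 3, 4}" by auto
  ultimately show ?thesis by (simp add: insert_commute numeral_2_eq_2[symmetric])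
qed

lemma C5_simple_graph: "simple_graph {0..<5} C5_edges"
  by (auto simp: simple_graph_def C5_edges_eq sym_def irrefl_def)

lemma C5_triangle_free: "triangle_free_graph C5_edges"
proof -
  have "\<forall>p\<in>C5_edges. \<forall>q\<in>C5_edges. snd p = fst q \<longrightarrow> (fst p, snd q) \<notin> C5_edges"
    unfolding C5_edges_eq by simp
  then show ?thesis unfolding triangle_free_graph_def by (metis fst_conv snd_conv)
qed

text \<open>The two brackets are the two orientations of the cycle; for symmetric \<open>h\<close>
  they coincide.\<close>

lemma sum_C5:
  fixes h :: "nat \<Rightarrow> nat \<Rightarrow> real"
  shows "(\<Sum>u\<in>{0..<5}. \<Sum>v\<in>{0..<5}. if (u, v) \<in> C5_edges then h u v else 0) =
    (h 0 1 + h 1 2 + h 2 3 + h 3 4 + h 4 0) + (h 1 0 + h 2 1 + h 3 2 + h 4 3 + h 0 4)"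
  by (simp add: C5_edges_eq atLeast0_lessThan_Suc eval_nat_numeral)

section \<open>Lower bound over fractional 2-colourings of the 5-cycle\<close>

lemma affine_ge_on_unit_interval:
  fixes f :: "real \<Rightarrow> real"
  assumes affine: "\<And>t. f t = (1 - t) * f 0 + t * f 1"
    and "c \<le> f 0" "c \<le> f 1" "t \<in> {0..1}"
  shows "c \<le> f t"
proof -
  have "c = (1 - t) * c + t * c" by algebra
  also have "\<dots> \<le> (1 - t) * f 0 + t * f 1"
    using assms(2-4) by (intro add_mono mult_left_mono) auto
  also have "\<dots> = f t" using affine[of t] by (rule sym)
  finally show ?thesis .
qed

text \<open>The left-hand side is affine in each variable, so its minimum over the cube is attained at a
  vertex, that is, at a 2-colouring of the 5-cycle.\<close>

lemma C5_fractional_colouring: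
  fixes a b c d e :: real
  assumes "a \<in> {0..1}" "b \<in> {0..1}" "c \<in> {0..1}" "d \<in> {0..1}" "e \<in> {0..1}"
  defines "m \<equiv> \<lambda>x y :: real. x * y + (1 - x) * (1 - y)"
  shows "m a b + m b c + m c d + m d e + m e a \<ge> 1"
proof -
  let ?F = "\<lambda>a b c d e. m a b + m b c + m c d + m d e + m e a"
  \<comment> \<open>Here \<open>m x y\<close> is the probability that independent random colours,
    equal to 1 with probabilities \<open>x\<close> and \<open>y\<close>, agree. At 0/1 values it
    marks the monochromatic edges, and an odd cycle always has one.\<close>
  have vertex: "1 \<le> ?F a b c d e" if "{a, b, c, d, e} \<subseteq> {0, 1}" for a b c d e
    using that by (auto simp: m_def)
  \<comment> \<open>The variables are released from \<open>{0, 1}\<close> to the interval one at a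
    time; each step applies the previous bound at both endpoints of the new variable.\<close>
  have affine_a: "1 \<le> ?F a b c d e"
    if "a \<in> {0..1}" "{b, c, d, e} \<subseteq> {0, 1}" for a b c d e
    by (rule affine_ge_on_unit_interval[of "\<lambda>a. ?F a b c d e"], simp add: m_def algebra_simps)
       (use vertex[of 0 b c d e] vertex[of 1 b c d e] that in simp_all)
  have affine_b: "1 \<le> ?F a b c d e"
    if "a \<in> {0..1}" "b \<in> {0..1}" "{c, d, e} \<subseteq> {0, 1}" for a b c d e
    by (rule affine_ge_on_unit_interval[of "\<lambda>b. ?F a b c d e"], simp add: m_def algebra_simps)
       (use affine_a[of a 0 c d e] affine_a[of a 1 c d e] that in simp_all)
  have affine_c: "1 \<le> ?F a b c d e"
    if "a \<in> {0..1}" "b \<in> {0..1}" "c \<in> {0..1}" "{d, e} \<subseteq> {0, 1}" for a b c d e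
    by (rule affine_ge_on_unit_interval[of "\<lambda>c. ?F a b c d e"], simp add: m_def algebra_simps)
       (use affine_b[of a b 0 d e] affine_b[of a b 1 d e] that in simp_all)
  have affine_d: "1 \<le> ?F a b c d e"
    if "a \<in> {0..1}" "b \<in> {0..1}" "c \<in> {0..1}" "d \<in> {0..1}" "{e} \<subseteq> {0, 1}" for a b c d e
    by (rule affine_ge_on_unit_interval[of "\<lambda>d. ?F a b c d e"], simp add: m_def algebra_simps)
       (use affine_c[of a b c 0 e] affine_c[of a b c 1 e] that in simp_all)
  have affine_e: "1 \<le> ?F a b c d e"
    if "a \<in> {0..1}" "b \<in> {0..1}" "c \<in> {0..1}" "d \<in> {0..1}" "e \<in> {0..1}" for a b c d e
    by (rule affine_ge_on_unit_interval[of "\<lambda>e. ?F a b c d e"], simp add: m_def algebra_simps)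
       (use affine_d[of a b c d 0] affine_d[of a b c d 1] that in simp_all)
  show ?thesis using affine_e[OF assms(1-5)] .
qed

locale C5_graphon = graph_graphon "{0..<5::nat}" C5_edges W P for W P
begin

text \<open>The fraction of part \<open>v\<close> coloured 1 is \<open>a v\<close>. The 25 comes
  from two parts of measure 1/5, the 2 from the two orientations of an edge.\<close>

lemma mono_density_C5:
  assumes "\<phi> \<in> colourings"
  defines "a \<equiv> \<lambda>v. 5 * measure unit_leb (P v \<inter> \<phi> -` {1})"
    and "m \<equiv> \<lambda>x y :: real. x * y + (1 - x) * (1 - y)"
  shows "mono_density W \<phi> =
    2 / 25 * (m (a 0) (a 1) + m (a 1) (a 2) + m (a 2) (a 3) + m (a 3) (a 4) + m (a 4) (a 0))"
proof -
  have zero: "measure unit_leb (P v \<inter> \<phi> -` {0}) = (1 - a v) / 5" if "v < 5" for v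
    using colour_class_measure[OF assms(1), of v] that by (simp add: a_def)
  have one: "measure unit_leb (P v \<inter> \<phi> -` {1}) = a v / 5" for v
    by (simp add: a_def)
  have pair: "(\<Sum>b\<in>{0, 1}. measure unit_leb (P u \<inter> \<phi> -` {b}) * measure unit_leb (P v \<inter> \<phi> -` {b})) =
      m (a u) (a v) / 25" if "u \<in> {0..<5}" "v \<in> {0..<5}" for u v
  proof -
    have "u < 5" "v < 5" using that by auto
    have "(\<Sum>b\<in>{0, 1}. measure unit_leb (P u \<inter> \<phi> -` {b}) * measure unit_leb (P v \<inter> \<phi> -` {b})) =
        measure unit_leb (P u \<inter> \<phi> -` {0}) * measure unit_leb (P v \<inter> \<phi> -` {0}) +
        measure unit_leb (P u \<inter> \<phi> -` {1}) * measure unit_leb (P v \<inter> \<phi> -` {1})" by simp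
    also have "\<dots> = m (a u) (a v) / 25"
      unfolding zero[OF \<open>u < 5\<close>] zero[OF \<open>v < 5\<close>] one by (simp add: m_def field_simps)
    finally show ?thesis .
  qed
  have comm: "m x y = m y x" for x y by (simp add: m_def)
  have "mono_density W \<phi> =
      (\<Sum>u\<in>{0..<5}. \<Sum>v\<in>{0..<5}. if (u, v) \<in> C5_edges then m (a u) (a v) / 25 else 0)"
    unfolding mono_density_eq[OF assms(1)] by (intro sum.cong refl if_cong pair)
  then show ?thesis
    unfolding sum_C5 comm[of "a 1" "a 0"] comm[of "a 2" "a 1"] comm[of "a 3" "a 2"]
      comm[of "a 4" "a 3"] comm[of "a 0" "a 4"]
    by (simp add: field_simps)
qed

lemma mono_density_ge:
  assumes "\<phi> \<in> colourings"
  shows "2 / 25 \<le> mono_density W \<phi>"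
proof -
  define a where "a v = 5 * measure unit_leb (P v \<inter> \<phi> -` {1})" for v
  have "a v \<in> {0..1}" if "v < 5" for v
  proof -
    have "measure unit_leb (P v \<inter> \<phi> -` {0}) + measure unit_leb (P v \<inter> \<phi> -` {1}) = 1 / 5"
      using colour_class_measure[OF assms, of v] that by simp
    moreover have "0 \<le> measure unit_leb (P v \<inter> \<phi> -` {0})" "0 \<le> measure unit_leb (P v \<inter> \<phi> -` {1})"
      by (rule measure_nonneg)+
    ultimately have "0 \<le> a v" "a v \<le> 1" unfolding a_def by linarith+
    then show ?thesis by simp
  qed
  then have "a 0 \<in> {0..1}" "a 1 \<in> {0..1}" "a 2 \<in> {0..1}" "a 3 \<in> {0..1}" "a 4 \<in> {0..1}"
    by simp_all
  note bound = C5_fractional_colouring[OF this]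
  show ?thesis
    unfolding mono_density_C5[OF assms] a_def[symmetric]
    by (rule mult_left_mono[OF bound, of "2 / 25", unfolded mult_1_right]) simp
qed

lemma d_mono_ge: "2 / 25 \<le> d_mono W"
proof -
  \<comment> \<open>A lower bound passes to the infimum only over a nonempty set of
    colourings.\<close>
  have "(\<lambda>x. 0) \<in> colourings" by (simp add: colourings_def)
  then show ?thesis
    unfolding d_mono_def by (intro cINF_greatest mono_density_ge) auto
qed

text \<open>If \<open>r\<close> lies in part \<open>k\<close>, then every \<open>a v\<close> is 0 or
  1, and the only monochromatic edge of the cycle is the one opposite to \<open>k\<close>, between
  \<open>k + 2\<close> and \<open>k + 3\<close> modulo 5.\<close>

lemma mono_density_neighbourhood:
  assumes "\<phi> \<in> colourings" "r \<in> {0..1}" "\<And>v. v \<in> {0..1} \<Longrightarrow> \<phi> v = (if W v r = 1 then 1 else 0)"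
  shows "mono_density W \<phi> = 2 / 25"
proof -
  obtain k where k: "k < 5" "r \<in> P k" using obtain_vertex[OF assms(2)] by auto
  have "5 * measure unit_leb (P v \<inter> \<phi> -` {1}) = (if (v, k) \<in> C5_edges then 1 else 0)"
    if v: "v < 5" for v
  proof -
    have "\<phi> x = (if (v, k) \<in> C5_edges then 1 else 0)" if "x \<in> P v" for x
    proof -
      have "x \<in> {0..1}" using that v cover by auto
      then show ?thesis using assms(3) W_eq[of v k x r] that v k by simp
    qed
    then have "P v \<inter> \<phi> -` {1} = (if (v, k) \<in> C5_edges then P v else {})" by auto
    then show ?thesis using P_measure[of v] v by simp
  qed
  moreover have "k = 0 \<or> k = 1 \<or> k = 2 \<or> k = 3 \<or> k = 4" using k by linarith
  ultimately show ?thesis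
    unfolding mono_density_C5[OF assms(1)] by (auto simp: C5_edges_eq)
qed

text \<open>Colouring by adjacency to the first root is optimal for every type, because the
  neighbourhood of a vertex of the 5-cycle is one side of a maximum cut.\<close>

lemma min_cond_cost_le:
  assumes "type_prob W \<sigma> \<noteq> 0"
  shows "(MIN c\<in>rules. cond_cost W \<sigma> c) \<le> 2 / 25"
proof -
  define c :: "(nat \<Rightarrow> real) \<Rightarrow> nat" where
    "c = (\<lambda>\<pi>\<in>{1..7} \<rightarrow>\<^sub>E {0, 1}. if \<pi> 1 = 1 then 1 else 0)"
  have c: "c \<in> rules" by (auto simp: rules_def c_def)
  have "mono_density W (rule_colouring W \<sigma> x c) = 2 / 25" if x: "x \<in> type_event W \<sigma>" for x
  proof (rule mono_density_neighbourhood)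
    let ?r = "canonical_roots W \<sigma> x"
    show "rule_colouring W \<sigma> x c \<in> colourings" using rule_colouring_in_colourings[OF c x] .
    show "?r 1 \<in> {0..1}" using canonical_roots_in[OF x] by simp
    fix v :: real assume "v \<in> {0..1}"
    then have "profile W ?r v \<in> {1..7} \<rightarrow>\<^sub>E {0, 1}"
      using canonical_roots_in[OF x] by (intro profile_in)
    then have "c (profile W ?r v) = (if profile W ?r v 1 = 1 then 1 else 0)"
      unfolding c_def by simp
    then show "rule_colouring W \<sigma> x c v = (if W v (?r 1) = 1 then 1 else 0)"
      by (simp add: rule_colouring_def profile_def)
  qed
  then have "(LINT x:type_event W \<sigma>|root_space. mono_density W (rule_colouring W \<sigma> x c)) =
      (LINT x:type_event W \<sigma>|root_space. 2 / 25)"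
    by (intro set_lebesgue_integral_cong type_event_sets) auto
  also have "\<dots> = 2 / 25 * type_prob W \<sigma>"
    using type_event_sets[of \<sigma>] by (simp add: set_lebesgue_integral_def type_prob_def)
  finally have "cond_cost W \<sigma> c = 2 / 25" using assms by (simp add: cond_cost_def)
  then show ?thesis using c finite_rules by (metis Min_le finite_imageI imageI)
qed

text \<open>The chain d_mono \<le> U7 \<le> 2/25 \<le> d_mono closes up: the general bound itself
  supplies the upper estimate of \<open>d_mono W\<close>.\<close>

lemma d_mono_eq_U7:
  assumes "canonical_types T"
  shows "d_mono W = U7 T W"
proof (rule antisym)
  show "d_mono W \<le> U7 T W" using d_mono_le_U7[OF assms triangle_free_graphon] .
  have "U7 T W \<le> (\<Sum>\<sigma>\<in>T. type_prob W \<sigma> * (2 / 25))"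
    unfolding U7_def
  proof (rule sum_mono)
    fix \<sigma>
    show "type_prob W \<sigma> * (MIN c\<in>rules. cond_cost W \<sigma> c) \<le> type_prob W \<sigma> * (2 / 25)"
    proof (cases "type_prob W \<sigma> = 0")
      case False
      have "0 \<le> type_prob W \<sigma>" unfolding type_prob_def by (rule measure_nonneg)
      then show ?thesis using min_cond_cost_le[OF False] by (rule mult_left_mono[rotated])
    qed simp
  qed
  also have "\<dots> = 2 / 25"
    unfolding sum_distrib_right[symmetric] sum_type_prob[OF assms triangle_free_graphon] by simp
  also have "\<dots> \<le> d_mono W" by (rule d_mono_ge)
  finally show "U7 T W \<le> d_mono W" .
qed

end

theorem lemma3p1:
  fixes T :: "(nat \<times> nat) set set"
  assumes "canonical_types T"
  shows "(\<forall>W. zero_one_step_graphon W \<and> triangle_free_graphon W \<longrightarrow> d_mono W \<le> U7 T W) \<and>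
    (\<forall>(V :: 'v set) E W. simple_graph V E \<and> V \<noteq> {} \<and> triangle_free_graph E \<and>
       is_graph_graphon V E W \<longrightarrow> d_mono W \<le> U7 T W) \<and>
    (\<forall>W. is_graph_graphon {0..<5} C5_edges W \<longrightarrow> d_mono W = U7 T W)"
proof (intro conjI allI impI)
  fix W assume W: "zero_one_step_graphon W \<and> triangle_free_graphon W"
  then obtain \<P> where "zero_one_step W \<P>"
    unfolding zero_one_step_graphon_def zero_one_step_def by blast
  then show "d_mono W \<le> U7 T W" using zero_one_step.d_mono_le_U7 assms W by blast
next
  fix V :: "'v set" and E W
  assume "simple_graph V E \<and> V \<noteq> {} \<and> triangle_free_graph E \<and> is_graph_graphon V E W"
  then obtain P where "graph_graphon V E W P" using graph_graphonI by blast
  then interpret graph_graphon V E W P .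
  show "d_mono W \<le> U7 T W" using d_mono_le_U7[OF assms triangle_free_graphon] .
next
  fix W assume W: "is_graph_graphon {0..<5} C5_edges W"
  obtain P where "graph_graphon {0..<5} C5_edges W P"
    using graph_graphonI[OF C5_simple_graph C5_triangle_free W] .
  then interpret C5_graphon W P by (simp add: C5_graphon_def)
  show "d_mono W = U7 T W" using d_mono_eq_U7[OF assms] .
qed

end
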